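(* Let $B$ be a left semi-brace. Then $E$ is an ideal of $B$ if and only if $e\cdot b=0$ for all $e\in E$ and $b\in B$.
   Context: A left semi-brace is a set $B$ with two operations $+$ and $\circ$ such that $(B,+)$ is a left cancellative semigroup (not necessarily commutative), $(B,\circ)$ is a group, and $a\circ(b+c)=a\circ b+a\circ(a^-+c)$ for all $a,b,c\in B$, where $a^-$ is the inverse of $a$ in $(B,\circ)$ and $\circ$ has higher precedence than $+$. The identity of $(B,\circ)$ is denoted $0$; it is an idempotent and a left identity of $(B,+)$. Let $E$ be the set of idempotents of $(B,+)$ and $G=B+0=\{b+0: b\in B\}$, which is a subgroup of $(B,+)$ (with identity $0$). For $a,b\in B$ put $\lambda_a(b)=a\circ(a^-+b)$, $\rho_b(a)=(a^-+b)^-\circ b$, and define the operation $a\cdot b=\lambda_a(a^-)+a\circ b+\lambda_b(b^-)$. A subsemigroup $I$ of $(B,+)$ is an ideal of $B$ if: (i) $I$ is a normal subgroup of $(B,\circ)$; (ii) $I\cap G$ is a normal subgroup of $(G,+)$; (iii) $\rho_b(n)\in I$ for all $b\in B$, $n\in I\cap G$; (iv) $\lambda_g(e)\in I$ for all $g\in G$, $e\in I\cap E$. *)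

theory Defs
  imports "HOL-Algebra.Coset"
begin

text \<open>
  The multiplicative part of the record is the group \<open>(B, \<circ>)\<close>: \<open>a \<otimes> b\<close> is \<open>a \<circ> b\<close>,
  \<open>inv a\<close> is \<open>a\<^sup>-\<close>, and \<open>\<one>\<close> is the element usually denoted \<open>0\<close>, which is also a left
  (not, in general, a right) identity of \<open>(B, +)\<close>. The additive operation is \<open>\<boxplus>\<close>; it
  binds weaker than \<open>\<otimes>\<close>.
\<close>

record 'a semi_brace = "'a monoid" +
  splus :: "['a, 'a] \<Rightarrow> 'a" (infixl "\<boxplus>\<index>" 65)

locale left_semi_brace = group B for B (structure) +
  assumes splus_closed [intro, simp]:
      "\<lbrakk>a \<in> carrier B; b \<in> carrier B\<rbrakk> \<Longrightarrow> a \<boxplus> b \<in> carrier B"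
    and splus_assoc:
      "\<lbrakk>a \<in> carrier B; b \<in> carrier B; c \<in> carrier B\<rbrakk> \<Longrightarrow> (a \<boxplus> b) \<boxplus> c = a \<boxplus> (b \<boxplus> c)"
    and splus_left_cancel:
      "\<lbrakk>a \<in> carrier B; b \<in> carrier B; c \<in> carrier B; a \<boxplus> b = a \<boxplus> c\<rbrakk> \<Longrightarrow> b = c"
    and mult_splus:
      "\<lbrakk>a \<in> carrier B; b \<in> carrier B; c \<in> carrier B\<rbrakk>
        \<Longrightarrow> a \<otimes> (b \<boxplus> c) = a \<otimes> b \<boxplus> a \<otimes> (inv a \<boxplus> c)"

definition idempotents :: "('a, 'm) semi_brace_scheme \<Rightarrow> 'a set" where
  "idempotents B = {e \<in> carrier B. e \<boxplus>\<^bsub>B\<^esub> e = e}"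

definition splus_group :: "('a, 'm) semi_brace_scheme \<Rightarrow> 'a monoid" where
  "splus_group B =
    \<lparr>carrier = (\<lambda>b. b \<boxplus>\<^bsub>B\<^esub> \<one>\<^bsub>B\<^esub>) ` carrier B, mult = (\<boxplus>\<^bsub>B\<^esub>), one = \<one>\<^bsub>B\<^esub>\<rparr>"

definition lambda_map :: "('a, 'm) semi_brace_scheme \<Rightarrow> 'a \<Rightarrow> 'a \<Rightarrow> 'a" where
  "lambda_map B a b = a \<otimes>\<^bsub>B\<^esub> (inv\<^bsub>B\<^esub> a \<boxplus>\<^bsub>B\<^esub> b)"

text \<open>The subscript comes first: \<open>rho_map B b a\<close> is \<open>\<rho>\<^sub>b(a)\<close>.\<close>

definition rho_map :: "('a, 'm) semi_brace_scheme \<Rightarrow> 'a \<Rightarrow> 'a \<Rightarrow> 'a" where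
  "rho_map B b a = inv\<^bsub>B\<^esub> (inv\<^bsub>B\<^esub> a \<boxplus>\<^bsub>B\<^esub> b) \<otimes>\<^bsub>B\<^esub> b"

definition dot :: "('a, 'm) semi_brace_scheme \<Rightarrow> 'a \<Rightarrow> 'a \<Rightarrow> 'a" where
  "dot B a b =
    lambda_map B a (inv\<^bsub>B\<^esub> a) \<boxplus>\<^bsub>B\<^esub> a \<otimes>\<^bsub>B\<^esub> b \<boxplus>\<^bsub>B\<^esub> lambda_map B b (inv\<^bsub>B\<^esub> b)"

locale semi_brace_ideal = left_semi_brace B + normal I B
  for I and B (structure) +
  assumes ideal_splus_closed: "\<lbrakk>a \<in> I; b \<in> I\<rbrakk> \<Longrightarrow> a \<boxplus> b \<in> I"
    and ideal_normal: "I \<inter> carrier (splus_group B) \<lhd> splus_group B"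
    and ideal_rho: "\<lbrakk>b \<in> carrier B; n \<in> I \<inter> carrier (splus_group B)\<rbrakk> \<Longrightarrow> rho_map B b n \<in> I"
    and ideal_lambda:
      "\<lbrakk>g \<in> carrier (splus_group B); e \<in> I \<inter> idempotents B\<rbrakk> \<Longrightarrow> lambda_map B g e \<in> I"

context left_semi_brace
begin

lemma one_splus [simp]: "c \<in> carrier B \<Longrightarrow> \<one> \<boxplus> c = c"
  using mult_splus[of \<one> \<one> c] splus_left_cancel[of \<one> "\<one> \<boxplus> c" c] by simp

lemma splus_right_inverse:
  assumes "b \<in> carrier B" shows "b \<boxplus> lambda_map B b (inv b) = \<one>"
  using mult_splus[of b \<one> "inv b"] assms by (simp add: lambda_map_def)

text \<open>
  HOL-Algebra's notion of a normal subgroup presupposes that the ambient structure is a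
  group, so \<open>ideal_normal\<close> relies on the following fact.
\<close>

lemma group_splus_group: "group (splus_group B)"
proof -
  let ?G = "splus_group B"
  have car: "x \<in> carrier B" if "x \<in> carrier ?G" for x
    using that by (auto simp: splus_group_def)
  have right_one: "x \<boxplus> \<one> = x" if "x \<in> carrier ?G" for x
    using that by (auto simp: splus_group_def splus_assoc)
  have carI: "x \<boxplus> \<one> \<in> carrier ?G" if "x \<in> carrier B" for x
    using that by (auto simp: splus_group_def)
  have right_inv: "\<exists>y\<in>carrier ?G. x \<boxplus> y = \<one>" if x: "x \<in> carrier ?G" for x
  proof
    let ?y = "lambda_map B x (inv x)"
    have y: "?y \<in> carrier B" using car[OF x] by (simp add: lambda_map_def)
    then show "?y \<boxplus> \<one> \<in> carrier ?G" by (rule carI)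
    show "x \<boxplus> (?y \<boxplus> \<one>) = \<one>"
      using y car[OF x] splus_right_inverse[OF car[OF x]]
      by (simp flip: splus_assoc)
  qed
  have left_inv: "\<exists>y\<in>carrier ?G. y \<boxplus> x = \<one>" if x: "x \<in> carrier ?G" for x
  proof -
    obtain y where y: "y \<in> carrier ?G" "x \<boxplus> y = \<one>" using right_inv[OF x] by blast
    obtain z where z: "z \<in> carrier ?G" "y \<boxplus> z = \<one>" using right_inv[OF y(1)] by blast
    note cars = car[OF x] car[OF y(1)] car[OF z(1)]
    have "x = x \<boxplus> (y \<boxplus> z)" using right_one[OF x] z by simp
    also have "\<dots> = z" using cars y by (simp flip: splus_assoc)
    finally show ?thesis using y z by blast
  qed
  have closed: "x \<boxplus> y \<in> carrier ?G" if "x \<in> carrier ?G" "y \<in> carrier ?G" for x y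
    using carI[of "x \<boxplus> y"] that car right_one[of y] by (simp add: splus_assoc)
  have one: "\<one> \<in> carrier ?G" using carI[of \<one>] by simp
  have ops: "x \<otimes>\<^bsub>?G\<^esub> y = x \<boxplus> y" "\<one>\<^bsub>?G\<^esub> = \<one>" for x y by (simp_all add: splus_group_def)
  show ?thesis
    by (rule groupI) (simp_all add: ops one closed left_inv car splus_assoc)
qed

end

end

theory Submission
  imports Defs
begin

text \<open>
  Each \<open>\<lambda>\<^sub>a\<close> is an endomorphism of the additive semigroup, so it preserves the set \<open>E\<close> of
  idempotents, and \<open>a \<circ> b = a + \<lambda>\<^sub>a(b)\<close>. As every idempotent is a left identity of \<open>(B, +)\<close>,
  it follows that \<open>E\<close> is a subgroup of \<open>(B, \<circ>)\<close>, that \<open>E\<close> meets \<open>G = B + 0\<close> only in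
  \<open>0\<close>, and that all conditions on an ideal except normality in \<open>(B, \<circ>)\<close> hold automatically for \<open>E\<close>
  (\<open>idempotents_ideal_iff_normal\<close>).

  Write \<open>b' = \<lambda>\<^sub>b(b\<^sup>-)\<close>, a right inverse of \<open>b\<close> in \<open>(B, +)\<close>. For \<open>e \<in> E\<close> the product
  \<open>e \<cdot> b\<close> is \<open>e \<circ> b + b'\<close>. If \<open>E\<close> is normal, then \<open>e \<circ> b = b \<circ> f = b + \<lambda>\<^sub>b(f)\<close> for some
  \<open>f \<in> E\<close>, and the idempotent \<open>\<lambda>\<^sub>b(f)\<close> disappears in \<open>b + \<lambda>\<^sub>b(f) + b' = b + b' = 0\<close>.
  Conversely, if \<open>e \<circ> b + b' = 0\<close>, then \<open>h = b' + e \<circ> b\<close> is idempotent and \<open>e \<circ> b = b + h\<close>, so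
  that \<open>b\<^sup>- \<circ> e \<circ> b = \<lambda>\<^bsub>b\<^sup>-\<^esub>(h)\<close> lies in \<open>E\<close>.
\<close>

context left_semi_brace
begin

lemma lambda_map_closed [simp]:
  "\<lbrakk>a \<in> carrier B; b \<in> carrier B\<rbrakk> \<Longrightarrow> lambda_map B a b \<in> carrier B"
  by (simp add: lambda_map_def)

lemma lambda_map_splus:
  assumes "a \<in> carrier B" "b \<in> carrier B" "c \<in> carrier B"
  shows "lambda_map B a (b \<boxplus> c) = lambda_map B a b \<boxplus> lambda_map B a c"
  using mult_splus[of a "inv a \<boxplus> b" c] assms by (simp add: lambda_map_def splus_assoc)

lemma mult_eq_splus_lambda_map:
  assumes "a \<in> carrier B" "b \<in> carrier B"
  shows "a \<otimes> b = a \<boxplus> lambda_map B a b"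
  using mult_splus[of a \<one> b] assms by (simp add: lambda_map_def)

lemma idempotentD: "e \<in> idempotents B \<Longrightarrow> e \<boxplus> e = e"
  by (simp add: idempotents_def)

lemma idempotentI: "\<lbrakk>e \<in> carrier B; e \<boxplus> e = e\<rbrakk> \<Longrightarrow> e \<in> idempotents B"
  by (simp add: idempotents_def)

lemma idempotents_closed [simp]: "e \<in> idempotents B \<Longrightarrow> e \<in> carrier B"
  by (simp add: idempotents_def)

lemma one_idempotent [simp]: "\<one> \<in> idempotents B"
  by (rule idempotentI) simp_all

lemma idempotent_splus [simp]:
  assumes "e \<in> idempotents B" "c \<in> carrier B"
  shows "e \<boxplus> c = c"
proof (rule splus_left_cancel[of e])
  show "e \<boxplus> (e \<boxplus> c) = e \<boxplus> c"
    using assms by (simp add: idempotentD flip: splus_assoc)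
qed (use assms in auto)

lemma lambda_map_idempotent:
  assumes "a \<in> carrier B" "e \<in> idempotents B"
  shows "lambda_map B a e \<in> idempotents B"
  using lambda_map_splus[of a e e] assms by (intro idempotentI) (simp_all add: idempotentD)

lemma idempotent_mult:
  assumes "e \<in> idempotents B" "c \<in> carrier B"
  shows "e \<otimes> c = lambda_map B e c"
  using assms by (simp add: mult_eq_splus_lambda_map)

lemma subgroup_idempotents: "subgroup (idempotents B) B"
proof (rule subgroupI)
  show "inv e \<in> idempotents B" if e: "e \<in> idempotents B" for e
  proof -
    \<comment> \<open>Both \<open>e \<circ> (e\<^sup>- + e\<^sup>-)\<close> and \<open>e \<circ> e\<^sup>-\<close> are \<open>\<lambda>\<^sub>e(e\<^sup>-) = 0\<close>.\<close>
    have "e \<otimes> (inv e \<boxplus> inv e) = e \<otimes> inv e"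
      using idempotent_mult[OF e, of "inv e"] e by (simp add: lambda_map_def)
    then have "inv e \<boxplus> inv e = inv e" using e by (subst (asm) Units_l_cancel) simp_all
    then show ?thesis using e by (intro idempotentI) simp_all
  qed
  show "e \<otimes> f \<in> idempotents B" if "e \<in> idempotents B" "f \<in> idempotents B" for e f
    using that by (simp add: idempotent_mult lambda_map_idempotent)
  show "idempotents B \<noteq> {}" using one_idempotent by blast
qed auto

lemma idempotents_Int_splus_group: "idempotents B \<inter> carrier (splus_group B) = {\<one>}"
proof -
  have "x = \<one>" if "x \<in> idempotents B" "x \<in> carrier (splus_group B)" for x
  proof -
    have "x \<boxplus> \<one> = x" using that(2) by (auto simp: splus_group_def splus_assoc)
    then show ?thesis using that(1) by simp
  qed
  moreover have "\<one> \<in> carrier (splus_group B)"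
    unfolding splus_group_def using one_splus[of \<one>] by force
  ultimately show ?thesis by auto
qed

lemma idempotents_ideal_iff_normal:
  "semi_brace_ideal (idempotents B) B \<longleftrightarrow> idempotents B \<lhd> B"
proof
  assume "semi_brace_ideal (idempotents B) B"
  then show "idempotents B \<lhd> B" by (rule semi_brace_ideal.axioms)
next
  assume normal: "idempotents B \<lhd> B"
  have "{\<one>\<^bsub>splus_group B\<^esub>} \<lhd> splus_group B"
    by (rule group.one_is_normal[OF group_splus_group])
  then have "{\<one>} \<lhd> splus_group B" by (simp add: splus_group_def)
  moreover have "g \<in> carrier B" if "g \<in> carrier (splus_group B)" for g
    using that by (auto simp: splus_group_def)
  ultimately have "semi_brace_ideal_axioms (idempotents B) B"
    by (intro semi_brace_ideal_axioms.intro)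
      (auto simp: idempotents_Int_splus_group lambda_map_idempotent rho_map_def)
  then show "semi_brace_ideal (idempotents B) B"
    by (intro semi_brace_ideal.intro left_semi_brace_axioms normal)
qed

lemma dot_idempotent:
  assumes "e \<in> idempotents B" "b \<in> carrier B"
  shows "dot B e b = e \<otimes> b \<boxplus> lambda_map B b (inv b)"
proof -
  have "lambda_map B e (inv e) = \<one>"
    using idempotent_mult[of e "inv e"] assms by simp
  then show ?thesis using assms by (simp add: dot_def)
qed

lemma dot_idempotent_eq_one_iff:
  assumes e: "e \<in> idempotents B" and b: "b \<in> carrier B"
  shows "dot B e b = \<one> \<longleftrightarrow> inv b \<otimes> e \<otimes> b \<in> idempotents B"
proof
  let ?b' = "lambda_map B b (inv b)"
  assume "dot B e b = \<one>"
  then have right_inv: "e \<otimes> b \<boxplus> ?b' = \<one>" using dot_idempotent[OF e b] by simp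
  let ?h = "?b' \<boxplus> e \<otimes> b"
  have car: "?b' \<in> carrier B" "e \<otimes> b \<in> carrier B" "?h \<in> carrier B" using e b by auto
  have "?h \<boxplus> ?h = ?b' \<boxplus> ((e \<otimes> b \<boxplus> ?b') \<boxplus> e \<otimes> b)"
    using car by (simp add: splus_assoc del: m_closed)
  then have h: "?h \<in> idempotents B"
    using car right_inv by (intro idempotentI) simp_all
  have "b \<boxplus> ?h = (b \<boxplus> ?b') \<boxplus> e \<otimes> b" using car b by (simp add: splus_assoc)
  then have "b \<boxplus> ?h = e \<otimes> b" using car b by (simp add: splus_right_inverse)
  then have "inv b \<otimes> e \<otimes> b = inv b \<otimes> (b \<boxplus> ?h)" using e b by (simp add: m_assoc)
  also have "\<dots> = lambda_map B (inv b) ?h" using b by (simp add: lambda_map_def)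
  finally show "inv b \<otimes> e \<otimes> b \<in> idempotents B"
    using lambda_map_idempotent[OF _ h, of "inv b"] b by simp
next
  let ?b' = "lambda_map B b (inv b)" and ?f = "inv b \<otimes> e \<otimes> b"
  assume f: "?f \<in> idempotents B"
  have "e \<otimes> b = b \<otimes> ?f" using e b by (simp flip: m_assoc)
  also have "\<dots> = b \<boxplus> lambda_map B b ?f"
    by (rule mult_eq_splus_lambda_map[OF b idempotents_closed[OF f]])
  finally have "e \<otimes> b \<boxplus> ?b' = b \<boxplus> (lambda_map B b ?f \<boxplus> ?b')"
    using b f by (simp add: splus_assoc)
  then show "dot B e b = \<one>"
    using e b f by (simp add: dot_idempotent lambda_map_idempotent splus_right_inverse)
qed

lemma idempotents_normal_iff:
  "idempotents B \<lhd> B \<longleftrightarrow>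
    (\<forall>e \<in> idempotents B. \<forall>b \<in> carrier B. inv b \<otimes> e \<otimes> b \<in> idempotents B)"
proof
  assume "idempotents B \<lhd> B"
  then show "\<forall>e \<in> idempotents B. \<forall>b \<in> carrier B. inv b \<otimes> e \<otimes> b \<in> idempotents B"
    by (auto intro: normal.inv_op_closed1)
next
  assume conj: "\<forall>e \<in> idempotents B. \<forall>b \<in> carrier B. inv b \<otimes> e \<otimes> b \<in> idempotents B"
  have "b \<otimes> e \<otimes> inv b \<in> idempotents B" if "b \<in> carrier B" "e \<in> idempotents B" for b e
    using conj[rule_format, of e "inv b"] that by simp
  then show "idempotents B \<lhd> B"
    by (simp add: normal_inv_iff subgroup_idempotents)
qed

end

theorem proposition13:
  fixes B :: "('a, 'm) semi_brace_scheme" (structure)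
  assumes "left_semi_brace B"
  shows "semi_brace_ideal (idempotents B) B \<longleftrightarrow>
    (\<forall>e \<in> idempotents B. \<forall>b \<in> carrier B. dot B e b = \<one>)"
proof -
  interpret left_semi_brace B by fact
  show ?thesis
    by (simp add: idempotents_ideal_iff_normal idempotents_normal_iff dot_idempotent_eq_one_iff)
qed

end
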